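(* Let $q=p^h$ with $p$ an odd prime, $p\neq 3$, and write $p=3k\pm1$ with $k$ a positive integer. Then there exists a good set $\Lambda\subseteq\mathbb{F}_q\setminus\{0\}$ of size $kq/p$.
   Context: A set $\Lambda\subseteq\mathbb{F}_q\setminus\{0\}$ is called good if $\lambda_1\lambda_2+\lambda_2\lambda_3+\lambda_1\lambda_3\neq 0$ for all $\lambda_1,\lambda_2,\lambda_3\in\Lambda$ (not necessarily distinct). *)

theory Defs
  imports Complex_Main "HOL-Computational_Algebra.Primes"
begin

definition good :: "'a::field set \<Rightarrow> bool" where
  "good \<Lambda> \<longleftrightarrow> \<Lambda> \<subseteq> UNIV - {0} \<and>
     (\<forall>x\<in>\<Lambda>. \<forall>y\<in>\<Lambda>. \<forall>z\<in>\<Lambda>. x * y + y * z + x * z \<noteq> 0)"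

end

theory Submission
  imports Defs "HOL-Number_Theory.Cong"
begin

text \<open>
  Since \<open>xy + yz + xz = xyz (1/x + 1/y + 1/z)\<close>, the inverses of a set \<open>M\<close> form a good set as soon
  as no three elements of \<open>M\<close> sum to zero. An additive subgroup \<open>H\<close> that is maximal among those not
  containing 1 is a hyperplane over the prime field, so the field is the disjoint union of the
  cosets \<open>H + i\<close> for \<open>0 \<le> i < p\<close>. The set \<open>M\<close> is the union of those with \<open>i\<close> in an interval of
  length \<open>k\<close> whose threefold sums avoid the multiples of \<open>p\<close>: \<open>{1..k}\<close> if \<open>p = 3k + 1\<close> and
  \<open>{k..2k - 1}\<close> if \<open>p = 3k - 1\<close>.
\<close>

text \<open>Translation by 1 permutes the ring, so adding 1 to every element leaves the total
  unchanged.\<close>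

lemma of_nat_card_UNIV_eq_0: "of_nat (card (UNIV :: 'a::{comm_ring_1,finite} set)) = (0::'a)"
proof -
  have "(\<Sum>x\<in>UNIV. x + 1) = (\<Sum>x\<in>UNIV. x :: 'a)"
    by (rule sum.reindex_bij_witness[where i = "\<lambda>x. x - 1" and j = "\<lambda>x. x + 1"]) auto
  then show ?thesis by (simp add: sum.distrib)
qed

text \<open>In positive characteristic an additive submonoid is already a subgroup.\<close>

definition add_submonoid :: "'a::comm_monoid_add set \<Rightarrow> bool" where
  "add_submonoid H \<longleftrightarrow> 0 \<in> H \<and> (\<forall>x\<in>H. \<forall>y\<in>H. x + y \<in> H)"

lemma add_submonoid_of_nat_mult:
  fixes H :: "'a::comm_semiring_1 set"
  assumes "add_submonoid H" "x \<in> H"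
  shows "of_nat n * x \<in> H"
  using assms by (induction n) (auto simp: add_submonoid_def algebra_simps)

lemma add_submonoid_uminus:
  fixes H :: "'a::comm_ring_1 set"
  assumes "add_submonoid H" "of_nat p = (0::'a)" "p > 0" "x \<in> H"
  shows "- x \<in> H"
proof -
  have "of_nat (p - 1) = (- 1 :: 'a)"
    using assms(2,3) by (simp add: of_nat_diff)
  then show ?thesis
    using add_submonoid_of_nat_mult[OF assms(1,4), of "p - 1"] by simp
qed

text \<open>An inverse of \<open>n\<close> modulo \<open>p\<close> becomes an inverse in the ring
  because \<open>p\<close> vanishes there.\<close>

lemma of_nat_inverse_exists:
  assumes "of_nat p = (0::'a::comm_ring_1)" "prime p" "\<not> p dvd n"
  obtains m where "of_nat n * of_nat m = (1::'a)"
proof -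
  have "coprime n p"
    using prime_imp_coprime[OF assms(2,3)] by (rule coprime_commute[THEN iffD1])
  then obtain m where "[n * m = 1] (mod p)"
    using cong_solve_coprime_nat by auto
  then obtain r s where "n * m + r * p = 1 + s * p"
    unfolding cong_iff_lin_nat by (metis mult.commute)
  then have "of_nat (n * m + r * p) = (of_nat (1 + s * p) :: 'a)"
    by (simp only:)
  with assms(1) that show thesis by simp
qed

text \<open>By maximality of \<open>H\<close>, adjoining some \<open>x\<close> outside
  \<open>H\<close> produces 1, say \<open>1 = h + n * x\<close>. Here \<open>n\<close> is
  invertible, so the equation can be solved for \<open>x\<close> modulo \<open>H\<close>.\<close>

lemma exists_complement_of_prime_field:
  fixes p :: nat
  assumes p: "prime p" "of_nat p = (0::'a)"
  obtains H :: "'a::{comm_ring_1,finite} set"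
    where "add_submonoid H" "1 \<notin> H" "\<And>x. \<exists>h\<in>H. \<exists>i<p. x = h + of_nat i"
proof -
  let ?P = "\<lambda>H :: 'a set. add_submonoid H \<and> 1 \<notin> H"
  have "{0} \<in> Collect ?P" by (simp add: add_submonoid_def)
  from finite_has_maximal2[OF finite this]
  obtain H where "H \<in> Collect ?P" "\<forall>K\<in>Collect ?P. H \<subseteq> K \<longrightarrow> H = K"
    by blast
  then have H: "add_submonoid H" "1 \<notin> H"
    and maximal: "\<And>K. ?P K \<Longrightarrow> H \<subseteq> K \<Longrightarrow> H = K"
    by simp_all
  \<comment> \<open>As \<open>p\<close> is zero in the ring, the bound \<open>i < p\<close> can
    always be achieved by reducing modulo \<open>p\<close>.\<close>
  have reduce: "\<exists>h\<in>H. \<exists>i<p. x = h + of_nat i" if "h \<in> H" "x = h + of_nat j" for x h j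
  proof -
    have "x = h + of_nat (j mod p)"
      unfolding that(2)
      by (metis add_0 div_mult_mod_eq mult_zero_right of_nat_add of_nat_mult p(2))
    moreover have "j mod p < p"
      using p(1) prime_gt_0_nat by simp
    ultimately show ?thesis
      using that(1) by blast
  qed
  have "\<exists>h\<in>H. \<exists>i<p. x = h + of_nat i" for x
  proof -
    \<comment> \<open>The submonoid generated by \<open>H\<close> and \<open>x\<close>.\<close>
    let ?K = "{h + of_nat n * x | h n. h \<in> H}"
    have zero: "0 \<in> H" and add: "\<And>a b. a \<in> H \<Longrightarrow> b \<in> H \<Longrightarrow> a + b \<in> H"
      using H(1) by (auto simp: add_submonoid_def)
    have "add_submonoid ?K"
      unfolding add_submonoid_def
    proof (intro conjI ballI)
      have "0 = 0 + of_nat 0 * x" by simp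
      with zero show "0 \<in> ?K" by blast
    next
      fix u v assume "u \<in> ?K" "v \<in> ?K"
      then obtain a m b n where
        "a \<in> H" "b \<in> H" "u = a + of_nat m * x" "v = b + of_nat n * x" by blast
      then have "u + v = (a + b) + of_nat (m + n) * x" "a + b \<in> H"
        using add by (simp_all add: algebra_simps)
      then show "u + v \<in> ?K" by blast
    qed
    moreover have "H \<subseteq> ?K"
    proof
      fix a assume "a \<in> H"
      moreover have "a = a + of_nat 0 * x" by simp
      ultimately show "a \<in> ?K" by blast
    qed
    ultimately have K: "H = ?K \<or> 1 \<in> ?K"
      using maximal by blast
    show ?thesis
    proof (cases "x \<in> H")
      case True
      then show ?thesis using reduce[of x x 0] by simp
    next
      case False
      have "0 + of_nat 1 * x \<in> ?K" using zero by blast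
      then have "x \<in> ?K" by simp
      with False K have "1 \<in> ?K" by blast
      then obtain h n where hn: "h \<in> H" "1 = h + of_nat n * x" by blast
      \<comment> \<open>Otherwise the term \<open>of_nat n * x\<close> vanishes and 1 is the element
        \<open>h\<close> of \<open>H\<close>.\<close>
      have "\<not> p dvd n"
      proof
        assume "p dvd n"
        then have "of_nat n = (0::'a)" using p(2) by (auto elim!: dvdE)
        with hn H(2) show False by simp
      qed
      then obtain m where "of_nat n * of_nat m = (1::'a)"
        using of_nat_inverse_exists[OF p(2,1)] by blast
      then have "x = of_nat m * (of_nat n * x)"
        by (metis mult.assoc mult.commute mult_1)
      also have "of_nat n * x = 1 - h" using hn(2) by (simp add: algebra_simps)
      finally have "x = of_nat m * (- h) + of_nat m" by (simp add: algebra_simps)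
      moreover have "of_nat m * (- h) \<in> H"
        using add_submonoid_of_nat_mult add_submonoid_uminus H(1) p prime_gt_0_nat hn(1) by blast
      ultimately show ?thesis by (rule reduce[rotated])
    qed
  qed
  with H show thesis by (rule that)
qed

text \<open>All threefold sums lie strictly between consecutive multiples of \<open>p\<close>: in
  the first case from 3 to \<open>3k\<close>, below \<open>p = 3k + 1\<close>; in the second from
  \<open>3k\<close> to \<open>6k - 3\<close>, between \<open>p = 3k - 1\<close> and
  \<open>2p = 6k - 2\<close>.\<close>

lemma exists_zero_sum_free_residues:
  fixes k p :: nat
  assumes "k > 0" "p = 3 * k + 1 \<or> p = 3 * k - 1"
  obtains S where "S \<subseteq> {..<p}" "card S = k"
    "\<And>a b c. a \<in> S \<Longrightarrow> b \<in> S \<Longrightarrow> c \<in> S \<Longrightarrow> \<not> p dvd a + b + c"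
proof -
  have between: "\<not> p dvd n" if "j * p < n" "n < Suc j * p" for j n
    using that by (metis dvdE mult.commute mult_less_cancel2 not_less_eq)
  show thesis
  proof (cases "p = 3 * k + 1")
    case True
    show thesis
    proof (rule that)
      show "{1..k} \<subseteq> {..<p}" using True by auto
      show "\<not> p dvd a + b + c" if "a \<in> {1..k}" "b \<in> {1..k}" "c \<in> {1..k}" for a b c
        using that True by (intro between[of 0]) auto
    qed simp
  next
    case False
    with assms have p: "p = 3 * k - 1" by simp
    show thesis
    proof (rule that)
      show "{k..<2*k} \<subseteq> {..<p}" using p by auto
      show "\<not> p dvd a + b + c" if "a \<in> {k..<2*k}" "b \<in> {k..<2*k}" "c \<in> {k..<2*k}" for a b c
        using that p by (intro between[of 1]) auto
    qed simp
  qed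
qed

lemma good_inverse_image:
  fixes M :: "'a::field set"
  assumes "\<And>x y z. x \<in> M \<Longrightarrow> y \<in> M \<Longrightarrow> z \<in> M \<Longrightarrow> x + y + z \<noteq> 0"
  shows "good (inverse ` M)"
proof -
  \<comment> \<open>The hypothesis with all three elements equal to \<open>x\<close> excludes
    0.\<close>
  have nz: "x \<noteq> 0" if "x \<in> M" for x
    using assms[OF that that that] by auto
  have "inverse x * inverse y + inverse y * inverse z + inverse x * inverse z \<noteq> 0"
    if "x \<in> M" "y \<in> M" "z \<in> M" for x y z
  proof -
    have "inverse x * inverse y + inverse y * inverse z + inverse x * inverse z
        = (x + y + z) * inverse (x * y * z)"
      using that nz by (simp add: field_simps)
    then show ?thesis using that nz assms[OF that] by simp
  qed
  with nz show ?thesis by (auto simp: good_def)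
qed

theorem theorem5:
  fixes p h k q :: nat
  assumes "prime p" and "odd p" and "p \<noteq> 3"
    and "h \<ge> 1" and "q = p ^ h"
    and "k > 0" and "p = 3 * k + 1 \<or> p = 3 * k - 1"
    and "card (UNIV :: 'a::{field,finite} set) = q"
  shows "\<exists>\<Lambda> :: 'a set. good \<Lambda> \<and> real (card \<Lambda>) = real k * real q / real p"
proof -
  have p0: "of_nat p = (0::'a)"
    using of_nat_card_UNIV_eq_0[where 'a='a] assms(5,8) by simp
  have p: "p > 0" using assms(1) prime_gt_0_nat by simp
  obtain H :: "'a set" where H: "add_submonoid H" "1 \<notin> H"
    and cover: "\<And>x. \<exists>h\<in>H. \<exists>i<p. x = h + of_nat i"
    using exists_complement_of_prime_field[OF assms(1) p0] by blast
  have add: "\<And>a b. a \<in> H \<Longrightarrow> b \<in> H \<Longrightarrow> a + b \<in> H"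
    using H(1) by (auto simp: add_submonoid_def)
  have neg: "\<And>a. a \<in> H \<Longrightarrow> - a \<in> H"
    using add_submonoid_uminus[OF H(1) p0 p] .
  \<comment> \<open>\<open>H\<close> meets the prime field only in 0: a nonzero element of the prime
    field has 1 among its multiples.\<close>
  have dvd: "p dvd n" if "of_nat n \<in> H" for n
  proof (rule ccontr)
    assume "\<not> p dvd n"
    then obtain m where "of_nat n * of_nat m = (1::'a)"
      using of_nat_inverse_exists[OF p0 assms(1)] by blast
    then show False
      using add_submonoid_of_nat_mult[OF H(1) that, of m] H(2) by (simp add: mult.commute)
  qed
  let ?f = "\<lambda>(h, i). h + of_nat i :: 'a"
  \<comment> \<open>The order \<open>i \<le> j\<close> keeps the natural subtraction exact. The
    difference lies in \<open>H\<close>, so \<open>p\<close> divides \<open>j - i\<close>, which is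
    less than \<open>p\<close>.\<close>
  have le: "i = j"
    if "a \<in> H" "b \<in> H" "j < p" "i \<le> j" "a + of_nat i = b + of_nat j" for a b :: 'a and i j
  proof -
    have "of_nat (j - i) = a + - b"
      using that by (simp add: of_nat_diff algebra_simps)
    then have "p dvd j - i"
      using dvd add neg that by metis
    then show ?thesis using that by (auto dest: dvd_imp_le)
  qed
  have inj: "inj_on ?f (H \<times> {..<p})"
  proof (rule inj_onI, clarsimp)
    fix a b :: 'a and i j
    assume *: "a \<in> H" "b \<in> H" "i < p" "j < p" "a + of_nat i = b + of_nat j"
    then have "i = j" using le[of a b j i] le[of b a i j] by (metis nat_le_linear)
    with * show "a = b \<and> i = j" by simp
  qed
  have "?f ` (H \<times> {..<p}) = UNIV"
    using cover by (force simp: image_iff)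
  \<comment> \<open>The \<open>p\<close> cosets of \<open>H\<close> partition the field;
    \<open>k\<close> of them therefore contain \<open>k * q / p\<close> elements.\<close>
  then have q: "q = card H * p"
    using card_image[OF inj] assms(8) by (simp add: card_cartesian_product)
  obtain S where S: "S \<subseteq> {..<p}" "card S = k"
    and free: "\<And>a b c. a \<in> S \<Longrightarrow> b \<in> S \<Longrightarrow> c \<in> S \<Longrightarrow> \<not> p dvd a + b + c"
    using exists_zero_sum_free_residues[OF assms(6,7)] by blast
  let ?M = "?f ` (H \<times> S)"
  have "good (inverse ` ?M)"
  proof (rule good_inverse_image)
    fix x y z assume "x \<in> ?M" "y \<in> ?M" "z \<in> ?M"
    then obtain u v w a b c where *: "u \<in> H" "v \<in> H" "w \<in> H" "a \<in> S" "b \<in> S" "c \<in> S"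
      "x = u + of_nat a" "y = v + of_nat b" "z = w + of_nat c"
      by auto
    show "x + y + z \<noteq> 0"
    proof
      assume "x + y + z = 0"
      then have "(u + v + w) + of_nat (a + b + c) = 0"
        using * by (simp add: algebra_simps)
      \<comment> \<open>A vanishing sum would put the sum of the residues into \<open>H\<close>,
        hence make it divisible by \<open>p\<close>, against the choice of \<open>S\<close>.\<close>
      then have "of_nat (a + b + c) = - (u + v + w)"
        by (metis add.inverse_unique)
      then have "p dvd a + b + c"
        using dvd add neg * by metis
      with free * show False by blast
    qed
  qed
  moreover have "card (inverse ` ?M) = card H * k"
  proof -
    have "card (inverse ` ?M) = card ?M"
      by (rule card_image) (simp add: inj_on_def)
    also have "\<dots> = card H * k"
      using card_image[OF inj_on_subset[OF inj, of "H \<times> S"]] S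
      by (auto simp: card_cartesian_product)
    finally show ?thesis .
  qed
  ultimately show ?thesis
    using q p by (intro exI[of _ "inverse ` ?M"]) simp
qed

end
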